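(* For any integer $d\ge3$ and any nonzero form $F\in\mathbb{R}[x,y]_d$, one has $\operatorname{ar-rk}(F)\le d-1$.
   Context: $\mathbb{R}[x,y]_d$ is the space of binary forms of degree $d$. For $f\in\mathbb{R}[x,y]$ let $\partial(f)$ be the differential operator obtained by replacing $x,y$ by $\partial/\partial x,\partial/\partial y$. For a nonzero form $F\in\mathbb{R}[x,y]_d$, the apolar ideal is the homogeneous ideal $(F)^\perp=\{f\in\mathbb{R}[x,y]:\partial(f)\bullet F=0\}$, with degree-$r$ part $(F)^\perp_r$. A nonzero form $g\in\mathbb{R}[x,y]_r$ has almost real roots if it has at least $r-2$ simple (i.e. multiplicity-one, pairwise non-proportional) linear factors over $\mathbb{R}$; for $r\ge2$ this means $g=q\prod_{i=1}^{r-2}l_i$ over $\mathbb{R}$ with $l_i$ linear, $q$ quadratic, and $l_1,\dots,l_{r-2},q$ pairwise relatively prime. The almost real rank $\operatorname{ar-rk}(F)$ is the minimal $r$ such that there exists a nonzero $g\in(F)^\perp_r$ with almost real roots. *)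

theory Defs
  imports Complex_Main "HOL-Computational_Algebra.Computational_Algebra"
    "HOL-Library.Extended_Nat"
begin

(* Elements of R[x,y] are represented as "real poly poly" = R[x][y]: the inner variable is x,
   the outer variable is y, so the coefficient of x^i y^j in p is "coeff (coeff p j) i". *)

type_synonym bipoly = "real poly poly"

definition is_form :: "nat \<Rightarrow> bipoly \<Rightarrow> bool" where
  "is_form d p \<longleftrightarrow> (\<forall>i j. coeff (coeff p j) i \<noteq> 0 \<longrightarrow> i + j = d)"

definition deriv_x :: "bipoly \<Rightarrow> bipoly" where
  "deriv_x = map_poly pderiv"

definition deriv_y :: "bipoly \<Rightarrow> bipoly" where
  "deriv_y = pderiv"

definition diff_op :: "bipoly \<Rightarrow> bipoly \<Rightarrow> bipoly" where
  "diff_op f F = (\<Sum>j\<le>degree f. \<Sum>i\<le>degree (coeff f j).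
     smult [:coeff (coeff f j) i:] ((deriv_x ^^ i) ((deriv_y ^^ j) F)))"

definition apolar_ideal :: "bipoly \<Rightarrow> bipoly set" where
  "apolar_ideal F = {f. diff_op f F = 0}"

definition apolar_part :: "bipoly \<Rightarrow> nat \<Rightarrow> bipoly set" where
  "apolar_part F r = {f \<in> apolar_ideal F. is_form r f}"

definition proportional :: "bipoly \<Rightarrow> bipoly \<Rightarrow> bool" where
  "proportional l m \<longleftrightarrow> (\<exists>c. c \<noteq> 0 \<and> l = smult [:c:] m)"

definition simple_linear_factor :: "bipoly \<Rightarrow> bipoly \<Rightarrow> bool" where
  "simple_linear_factor l g \<longleftrightarrow> l \<noteq> 0 \<and> is_form 1 l \<and> l dvd g \<and> \<not> l ^ 2 dvd g"

(* The bound "at least r - 2" is written without subtraction; it is vacuous for r \<le> 2. *)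
definition almost_real_roots :: "nat \<Rightarrow> bipoly \<Rightarrow> bool" where
  "almost_real_roots r g \<longleftrightarrow> g \<noteq> 0 \<and> is_form r g \<and>
     (\<exists>L. finite L \<and> r \<le> card L + 2 \<and>
        (\<forall>l\<in>L. simple_linear_factor l g) \<and>
        (\<forall>l\<in>L. \<forall>m\<in>L. l \<noteq> m \<longrightarrow> \<not> proportional l m))"

(* Valued in enat, so that the rank would be \<infinity> if no such g existed in any degree. *)
definition ar_rk :: "bipoly \<Rightarrow> enat" where
  "ar_rk F = (INF r\<in>{r. \<exists>g\<in>apolar_part F r. almost_real_roots r g}. enat r)"

end

(* Let n = d - 3 and let P be a product of n distinct real lines. Contraction with F sends forms of
   degree d - 1 to linear forms, so P q is apolar to F for some nonzero quadratic form q: three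
   unknowns, two equations. The form P q has n simple lines, even when q shares exactly one line
   with P, since the cofactor of that line in q is then a new simple line. The only bad case is
   that q is a multiple of l l' with l, l' (possibly equal) among the lines of P.
   As F is nonzero, some power (y - t x)^(d-1) is not apolar to F. If all lines of P are close to
   y - t x, then by continuity no P l l' is apolar to F, and the bad case is excluded. *)

theory Submission imports Defs begin

section \<open>Forms and contraction\<close>

lemma is_form_mult:
  assumes "is_form m p" and "is_form n q"
  shows "is_form (m + n) (p * q)"
  unfolding is_form_def
proof (intro allI impI)
  fix i j
  assume "coeff (coeff (p * q) j) i \<noteq> 0"
  then have "(\<Sum>v\<le>j. \<Sum>u\<le>i. coeff (coeff p v) u * coeff (coeff q (j - v)) (i - u)) \<noteq> 0"
    by (simp add: coeff_mult coeff_sum)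
  then obtain v where v: "v \<le> j"
    and "(\<Sum>u\<le>i. coeff (coeff p v) u * coeff (coeff q (j - v)) (i - u)) \<noteq> 0"
    by (meson atMost_iff sum.not_neutral_contains_not_neutral)
  then obtain u where u: "u \<le> i" "coeff (coeff p v) u * coeff (coeff q (j - v)) (i - u) \<noteq> 0"
    by (meson atMost_iff sum.not_neutral_contains_not_neutral)
  then have "u + v = m" "i - u + (j - v) = n"
    using assms unfolding is_form_def by auto
  with v u show "i + j = m + n" by linarith
qed

lemma is_form_1: "is_form 0 1"
  by (auto simp: is_form_def coeff_1 split: if_splits)

lemma is_form_prod:
  assumes "\<And>c. c \<in> C \<Longrightarrow> is_form 1 (f c)"
  shows "is_form (card C) (\<Prod>c\<in>C. f c)"
  using assms
proof (induction C rule: infinite_finite_induct)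
  case (insert c C)
  then have "is_form (1 + card C) (f c * prod f C)"
    by (intro is_form_mult) auto
  with insert show ?case by simp
qed (simp_all add: is_form_1)

section \<open>Coefficients of the contraction of a form\<close>

lemma coeff_coeff_smult: "coeff (coeff (smult [:k:] p) j) i = k * coeff (coeff p j) i"
  for p :: bipoly
  by simp

lemma coeff_deriv_x_funpow: "coeff ((deriv_x ^^ i) p) n = (pderiv ^^ i) (coeff p n)"
  by (induction i) (simp_all add: deriv_x_def coeff_map_poly)

lemma pochhammer_const_poly: "pochhammer (of_nat n) k = [:pochhammer (of_nat n) k :: real:]"
  by (induction k) (simp_all add: pochhammer_Suc of_nat_poly one_pCons)

text \<open>The rising factorial (a+1)...(a+i) = (a+i)!/a! is the factor that i derivatives in x put
  on x^(a+i); likewise for y.\<close>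

lemma coeff_coeff_derivs:
  "coeff (coeff ((deriv_x ^^ i) ((deriv_y ^^ j) F)) b) a =
     pochhammer (of_nat (Suc a)) i * (pochhammer (of_nat (Suc b)) j * coeff (coeff F (b + j)) (a + i))"
  unfolding coeff_deriv_x_funpow deriv_y_def coeff_higher_pderiv pochhammer_const_poly
  by simp

text \<open>The coefficient of \<open>x\<^sup>a y\<^sup>b\<close> in \<open>\<partial>(f) \<bullet> F\<close>, for a form \<open>f\<close> of degree \<open>n\<close>.\<close>

definition contr :: "nat \<Rightarrow> bipoly \<Rightarrow> nat \<Rightarrow> nat \<Rightarrow> bipoly \<Rightarrow> real" where
  "contr n F a b f = (\<Sum>j\<le>n. coeff (coeff f j) (n - j) *
     (pochhammer (of_nat (Suc a)) (n - j) *
       (pochhammer (of_nat (Suc b)) j * coeff (coeff F (b + j)) (a + (n - j)))))"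

lemma contr_add: "contr n F a b (f + g) = contr n F a b f + contr n F a b g"
  by (simp add: contr_def sum.distrib distrib_right)

lemma contr_smult: "contr n F a b (smult [:k:] f) = k * contr n F a b f"
  unfolding contr_def coeff_coeff_smult by (simp add: sum_distrib_left mult.assoc)

text \<open>In a form of degree n only the terms with i + j = n survive, so the double sum collapses
  to its antidiagonal.\<close>

lemma diff_op_form:
  assumes "is_form n f"
  shows "diff_op f F =
    (\<Sum>j\<le>n. smult [:coeff (coeff f j) (n - j):] ((deriv_x ^^ (n - j)) ((deriv_y ^^ j) F)))"
proof -
  define T where "T = (\<lambda>j i. smult [:coeff (coeff f j) i:] ((deriv_x ^^ i) ((deriv_y ^^ j) F)))"
  have zero: "T j i = 0" if "i + j \<noteq> n" for i j
    using assms that unfolding is_form_def T_def by force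
  have "(\<Sum>i\<le>degree (coeff f j). T j i) = (if j \<le> n then T j (n - j) else 0)" for j
  proof (cases "j \<le> n \<and> n - j \<le> degree (coeff f j)")
    case True
    have "(\<Sum>i\<le>degree (coeff f j). T j i) = (\<Sum>i\<in>{n - j}. T j i)"
      using True by (intro sum.mono_neutral_right) (auto intro!: zero)
    with True show ?thesis by simp
  next
    case False
    then have "(\<Sum>i\<le>degree (coeff f j). T j i) = 0"
      by (intro sum.neutral) (auto intro!: zero)
    \<comment> \<open>Here n - j exceeds the degree of \<open>coeff f j\<close>, so that coefficient
      is 0 and the uniform formula remains valid.\<close>
    moreover have "T j (n - j) = 0" if "j \<le> n"
      using that False by (simp add: T_def coeff_eq_0)
    ultimately show ?thesis by simp
  qed
  then have "diff_op f F = (\<Sum>j\<le>degree f. if j \<le> n then T j (n - j) else 0)"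
    unfolding diff_op_def T_def by simp
  also have "\<dots> = (\<Sum>j\<in>{..degree f} \<inter> {..n}. T j (n - j))"
    by (subst sum.inter_restrict) simp_all
  also have "\<dots> = (\<Sum>j\<le>n. T j (n - j))"
    by (intro sum.mono_neutral_left) (auto simp: T_def coeff_eq_0)
  finally show ?thesis by (simp add: T_def)
qed

lemma coeff_coeff_diff_op:
  assumes "is_form n f"
  shows "coeff (coeff (diff_op f F) b) a = contr n F a b f"
  unfolding diff_op_form[OF assms] contr_def coeff_sum coeff_coeff_smult coeff_coeff_derivs ..

text \<open>After n derivatives a form of degree n + 1 becomes linear, so only its coefficients at x
  and y need checking.\<close>

lemma apolar_if_contr_eq_0:
  assumes f: "is_form n f" and F: "is_form (Suc n) F"
    and 0: "contr n F 1 0 f = 0" "contr n F 0 1 f = 0"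
  shows "f \<in> apolar_part F n"
proof -
  have "contr n F a b f = 0" for a b
  proof (cases "a + b = 1")
    case True
    then have "a = 1 \<and> b = 0 \<or> a = 0 \<and> b = 1" by linarith
    with 0 show ?thesis by auto
  next
    case False
    \<comment> \<open>The monomial in question has total degree a + b + n, which differs from n +
      1.\<close>
    then have "coeff (coeff F (b + j)) (a + (n - j)) = 0" if "j \<le> n" for j
      using F that unfolding is_form_def by fastforce
    then show ?thesis unfolding contr_def by (intro sum.neutral) simp
  qed
  then have "diff_op f F = 0"
    by (simp add: poly_eq_iff coeff_coeff_diff_op[OF f])
  with f show ?thesis by (simp add: apolar_part_def apolar_ideal_def)
qed

section \<open>Lines\<close>

text \<open>The form y - c x, monic in y. As \<open>[:0, c:]\<close> is c x, substituting it for y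
  tests divisibility by this form.\<close>

definition line :: "real \<Rightarrow> bipoly" where
  "line c = [:[:0, - c:], 1:]"

lemma poly_line [simp]: "poly (line c) [:0, e:] = [:0, e - c:]"
  by (simp add: line_def)

lemma line_dvd_iff: "line c dvd p \<longleftrightarrow> poly p [:0, c:] = 0"
  by (simp add: poly_eq_0_iff_dvd line_def)

lemma line_neq_0 [simp]: "line c \<noteq> 0"
  by (simp add: line_def)

lemma coeff_coeff_line:
  "coeff (coeff (line c) j) i = (if i = 1 \<and> j = 0 then - c else if i = 0 \<and> j = 1 then 1 else 0)"
  by (auto simp: line_def coeff_pCons split: nat.splits)

lemma lead_coeff_line: "lead_coeff (line c) = 1"
  by (simp add: line_def)

lemma is_form_linear: "is_form 1 [:[:0, u:], [:v:]:]"
  by (auto simp: is_form_def coeff_pCons split: nat.splits)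

lemma is_form_line: "is_form 1 (line c)"
  using is_form_linear[of "- c" 1] by (simp add: line_def one_pCons)

lemma is_form_quadratic: "is_form 2 [:[:0, 0, a:], [:0, b:], [:k:]:]"
  by (auto simp: is_form_def coeff_pCons split: nat.splits)

lemma inj_line: "inj line"
  by (auto simp: inj_def line_def)

lemma proportional_imp_poly_eq_0:
  assumes "proportional l m"
  shows "poly l z = 0 \<longleftrightarrow> poly m z = 0"
  using assms unfolding proportional_def by auto

lemma proportional_line_imp_eq: "proportional (line c) (line e) \<Longrightarrow> c = e"
  using proportional_imp_poly_eq_0[of "line c" "line e" "[:0, c:]"] by auto

lemma poly_prod_line:
  "finite C \<Longrightarrow> e \<notin> C \<Longrightarrow> poly (\<Prod>c\<in>C. line c) [:0, e:] \<noteq> 0"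
  by (auto simp: poly_prod)

section \<open>Simple linear factors of products of lines with a quadratic form\<close>

lemma simple_linear_factor_mult:
  assumes "l \<noteq> 0" "is_form 1 l" "\<not> l dvd h"
  shows "simple_linear_factor l (l * h)"
  using assms by (simp add: simple_linear_factor_def power2_eq_square)

lemma simple_line:
  assumes "poly h [:0, c:] \<noteq> 0"
  shows "simple_linear_factor (line c) (line c * h)"
  using assms by (intro simple_linear_factor_mult) (auto simp: is_form_line[simplified] line_dvd_iff)

text \<open>If v = 0, then u x would divide the leading coefficient 1, which is impossible.
  Otherwise u x + v y vanishes at y = -(u/v) x, and so does every multiple of it.\<close>

lemma linear_dvd_monic:
  fixes H :: bipoly
  assumes H: "lead_coeff H = 1" and dvd: "[:[:0, u:], [:v:]:] dvd H"
    and "u \<noteq> 0 \<or> v \<noteq> 0"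
  shows "\<exists>e. u + v * e = 0 \<and> poly H [:0, e:] = 0"
proof (cases "v = 0")
  case True
  then have "[:[:0, u:]:] dvd H" using dvd by simp
  then have "[:0, u:] dvd coeff H (degree H)"
    using const_poly_dvd_iff[of "[:0, u:]" H] by blast
  then obtain r where "1 = [:0, u:] * r" using H by (auto elim: dvdE)
  then have "poly 1 (0::real) = poly ([:0, u:] * r) 0" by metis
  then show ?thesis by simp
next
  case False
  then have u: "u + v * (- u / v) = 0" by (simp add: field_simps)
  obtain r where "H = [:[:0, u:], [:v:]:] * r" using dvd by (auto elim: dvdE)
  moreover have "poly [:[:0, u:], [:v:]:] [:0, - u / v:] = 0"
    using False by simp
  ultimately have "poly H [:0, - u / v:] = 0" by (metis poly_mult mult_zero_left)
  with u show ?thesis by blast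
qed

text \<open>If q vanishes on no line of \<open>C\<close>, these lines are the simple factors.
  Otherwise q = \<open>line c * m\<close>; then \<open>line c\<close> is lost as a double factor and
  m takes its place.\<close>

lemma almost_real_roots_lines_mult_quadratic:
  fixes a b k :: real
  defines "q \<equiv> [:[:0, 0, a:], [:0, b:], [:k:]:]"
  assumes C: "finite C" and nz: "a \<noteq> 0 \<or> b \<noteq> 0 \<or> k \<noteq> 0"
    and bad: "\<And>c e s. c \<in> C \<Longrightarrow> e \<in> C \<Longrightarrow> q \<noteq> smult [:s:] (line c * line e)"
  shows "almost_real_roots (card C + 2) ((\<Prod>c\<in>C. line c) * q)"
proof -
  let ?P = "\<Prod>c\<in>C. line c"
  have q0: "q \<noteq> 0" using nz by (auto simp: q_def)
  then have g0: "?P * q \<noteq> 0" using C by auto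
  have form: "is_form (card C + 2) (?P * q)"
    unfolding q_def by (intro is_form_mult is_form_prod is_form_quadratic is_form_line)
  have remove: "?P = line c * (\<Prod>c\<in>C - {c}. line c)" if "c \<in> C" for c
    using C that by (simp add: prod.remove)
  have rest: "poly (\<Prod>c\<in>C - {c}. line c) [:0, c:] \<noteq> 0" for c
    using C by (intro poly_prod_line) auto
  have "\<exists>L. finite L \<and> card C + 2 \<le> card L + 2 \<and> (\<forall>l\<in>L. simple_linear_factor l (?P * q)) \<and>
        (\<forall>l\<in>L. \<forall>m\<in>L. l \<noteq> m \<longrightarrow> \<not> proportional l m)"
  proof (cases "\<exists>c\<in>C. poly q [:0, c:] = 0")
    case False
    have "simple_linear_factor (line c) (?P * q)" if "c \<in> C" for c
    proof -
      have "simple_linear_factor (line c) (line c * ((\<Prod>c\<in>C - {c}. line c) * q))"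
        using False that rest[of c] by (intro simple_line) auto
      then show ?thesis by (simp only: remove[OF that] mult.assoc)
    qed
    then show ?thesis
      using C by (intro exI[of _ "line ` C"])
        (auto simp: card_image inj_on_subset[OF inj_line] dest: proportional_line_imp_eq)
  next
    case True
    then obtain c where c: "c \<in> C" and root: "poly q [:0, c:] = 0" by blast
    \<comment> \<open>Substituting y = c x in q gives (a + c (b + c k)) x^2.\<close>
    have "a + c * (b + c * k) = 0" using root by (simp add: q_def algebra_simps)
    then have a: "a = - c * (b + c * k)" by (simp add: algebra_simps)
    \<comment> \<open>The quotient of q by y - c x. For k = 0 it is a multiple of x, hence
      proportional to no \<open>line e\<close>.\<close>
    define m :: bipoly where "m = [:[:0, b + k * c:], [:k:]:]"
    have qm: "q = line c * m"
      by (simp add: q_def m_def line_def a algebra_simps)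
    have mroot: "poly m [:0, e:] = 0 \<longleftrightarrow> b + k * c + k * e = 0" for e
      by (simp add: m_def algebra_simps)
    have m: "poly m [:0, e:] \<noteq> 0" if "e \<in> C" for e
    proof
      assume "poly m [:0, e:] = 0"
      then have "b + k * c = - k * e" by (simp add: mroot)
      then have "m = smult [:k:] (line e)" by (simp add: m_def line_def)
      then have "q = smult [:k:] (line c * line e)" by (simp add: qm)
      with bad[OF c that] show False by blast
    qed
    let ?L = "insert m (line ` (C - {c}))"
    have m_notin: "m \<notin> line ` (C - {c})"
    proof
      assume "m \<in> line ` (C - {c})"
      then obtain e where "e \<in> C" "m = line e" by blast
      with m[of e] show False by simp
    qed
    have "card (line ` (C - {c})) = card C - 1"
      using c C by (simp add: card_image inj_on_subset[OF inj_line])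
    moreover have "card C > 0" using c C card_gt_0_iff by blast
    ultimately have card: "card ?L = card C"
      using C m_notin by (simp add: card_insert_disjoint)
    have "simple_linear_factor m (m * (?P * line c))"
    proof (rule simple_linear_factor_mult)
      show "m \<noteq> 0" using q0 qm by auto
      show "is_form 1 m" unfolding m_def by (rule is_form_linear)
      show "\<not> m dvd ?P * line c"
      proof
        assume dvd: "m dvd ?P * line c"
        \<comment> \<open>The product is monic in y and vanishes only on lines of \<open>C\<close>,
          so m could divide it only by vanishing on one of them.\<close>
        have "lead_coeff (?P * line c) = 1"
          by (simp add: lead_coeff_mult lead_coeff_prod lead_coeff_line)
        moreover have "b + k * c \<noteq> 0 \<or> k \<noteq> 0" using \<open>m \<noteq> 0\<close> by (auto simp: m_def)
        ultimately obtain e where e: "b + k * c + k * e = 0" "poly (?P * line c) [:0, e:] = 0"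
          using dvd linear_dvd_monic unfolding m_def by blast
        then have "e \<in> C" using C c poly_prod_line[of C e] by auto
        with m e(1) show False by (simp add: mroot)
      qed
    qed
    then have simple_m: "simple_linear_factor m (?P * q)" by (simp add: qm mult_ac)
    have simple_l: "simple_linear_factor (line e) (?P * q)" if "e \<in> C - {c}" for e
    proof -
      have "simple_linear_factor (line e) (line e * ((\<Prod>c\<in>C - {e}. line c) * q))"
        using that rest[of e] m by (intro simple_line) (auto simp: qm)
      moreover have "line e * ((\<Prod>c\<in>C - {e}. line c) * q) = ?P * q"
        using that by (simp only: remove[of e] mult.assoc Diff_iff)
      ultimately show ?thesis by simp
    qed
    have "\<not> proportional m (line e)" "\<not> proportional (line e) m" if "e \<in> C" for e
      using m[OF that] proportional_imp_poly_eq_0[of m "line e" "[:0, e:]"]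
        proportional_imp_poly_eq_0[of "line e" m "[:0, e:]"] by auto
    with C card simple_m simple_l show ?thesis
      by (intro exI[of _ ?L]) (auto dest: proportional_line_imp_eq)
  qed
  with g0 form show ?thesis by (simp add: almost_real_roots_def)
qed

section \<open>Apolar products of lines\<close>

text \<open>Gaussian elimination. The unknowns will be the coefficients of q, the equations the
  vanishing of both coefficients of a linear form.\<close>

lemma two_equations_three_unknowns:
  fixes a1 a2 a3 b1 b2 b3 :: real
  shows "\<exists>x y z. (x \<noteq> 0 \<or> y \<noteq> 0 \<or> z \<noteq> 0) \<and>
    x * a1 + y * a2 + z * a3 = 0 \<and> x * b1 + y * b2 + z * b3 = 0"
proof -
  have one: "\<exists>y z. (y \<noteq> 0 \<or> z \<noteq> 0) \<and> y * u + z * v = 0" for u v :: real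
  proof (cases "u = 0")
    case True
    then show ?thesis by (intro exI[of _ 1] exI[of _ 0]) simp
  next
    case False
    then show ?thesis by (intro exI[of _ v] exI[of _ "- u"]) simp
  qed
  have pivot: "\<exists>x y z. (x \<noteq> 0 \<or> y \<noteq> 0 \<or> z \<noteq> 0) \<and>
      x * a1 + y * a2 + z * a3 = 0 \<and> x * b1 + y * b2 + z * b3 = 0"
    if a1: "a1 \<noteq> 0" for a1 a2 a3 b1 b2 b3 :: real
  proof -
    \<comment> \<open>This is the second equation after eliminating x by the first, multiplied by
      a1.\<close>
    obtain y z where yz: "y \<noteq> 0 \<or> z \<noteq> 0"
      "y * (b2 * a1 - a2 * b1) + z * (b3 * a1 - a3 * b1) = 0"
      using one by blast
    let ?x = "- (y * a2 + z * a3) / a1"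
    have "?x * b1 + y * b2 + z * b3 = 0"
      using yz(2) a1 by (simp add: field_simps)
    moreover have "?x * a1 + y * a2 + z * a3 = 0" using a1 by simp
    ultimately show ?thesis using yz(1) by blast
  qed
  consider "a1 \<noteq> 0" | "b1 \<noteq> 0" | "a1 = 0" "b1 = 0" by blast
  then show ?thesis
  proof cases
    case 1
    then show ?thesis by (rule pivot)
  next
    case 2
    then show ?thesis using pivot[of b1 b2 b3 a1 a2 a3] by blast
  next
    case 3
    then show ?thesis by (intro exI[of _ 1] exI[of _ 0]) simp
  qed
qed

section \<open>Powers of lines detect nonzero forms\<close>

lemma linear_power: "[:0, c:] ^ k = monom (c ^ k) k" for c :: real
  by (induction k) (simp_all add: monom_Suc monom_0 mult_ac smult_monom)

lemma coeff_coeff_line_power: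
  "j \<le> n \<Longrightarrow> coeff (coeff (line c ^ n) j) (n - j) = of_nat (n choose j) * (- c) ^ (n - j)"
  unfolding line_def coeff_linear_poly_power
  by (simp add: linear_power of_nat_poly)

text \<open>For fixed a, b the contraction is a polynomial in t whose coefficients are nonzero
  multiples of coefficients of F. If it vanished for all t and both choices of (a, b), F would be
  0.\<close>

lemma ex_contr_line_power_neq_0:
  assumes F: "is_form (Suc n) F" "F \<noteq> 0"
  shows "\<exists>t a b. a + b = 1 \<and> contr n F a b (line t ^ n) \<noteq> 0"
proof (rule ccontr)
  assume "\<not> ?thesis"
  then have 0: "contr n F a b (line t ^ n) = 0" if "a + b = 1" for a b t
    using that by blast
  have coeff_0: "coeff (coeff F (b + j)) (a + (n - j)) = 0" if ab: "a + b = 1" and "j \<le> n" for a b j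
  proof -
    \<comment> \<open>\<open>w j\<close> is the coefficient of s^(n-j) in the contraction with (y +
      s x)^n; taking t = -s removes the signs.\<close>
    define w where "w = (\<lambda>j. of_nat (n choose j) * (pochhammer (of_nat (Suc a)) (n - j) *
       (pochhammer (of_nat (Suc b)) j * coeff (coeff F (b + j)) (a + (n - j)))) :: real)"
    have "(\<Sum>i\<le>n. w (n - i) * s ^ i) = 0" for s
    proof -
      have "0 = contr n F a b (line (- s) ^ n)" using 0[OF ab] by simp
      also have "\<dots> = (\<Sum>j\<le>n. w j * s ^ (n - j))"
        unfolding contr_def by (intro sum.cong refl) (simp add: coeff_coeff_line_power w_def mult_ac)
      also have "\<dots> = (\<Sum>i\<le>n. w (n - i) * s ^ i)"
        by (rule sum.reindex_bij_witness[of _ "\<lambda>i. n - i" "\<lambda>i. n - i"]) auto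
      finally show ?thesis by simp
    qed
    then have "\<forall>i\<le>n. w (n - i) = 0" using polyfun_eq_0[where c = "\<lambda>i. w (n - i)" and n = n] by blast
    then have "w (n - (n - j)) = 0" using diff_le_self by blast
    then have "w j = 0" using \<open>j \<le> n\<close> by simp
    moreover have "pochhammer (of_nat (Suc m)) l \<noteq> (0::real)" for m l
      by (metis pochhammer_pos of_nat_0_less_iff zero_less_Suc less_irrefl)
    ultimately show ?thesis
      using \<open>j \<le> n\<close> by (simp add: w_def del: of_nat_Suc)
  qed
  have "coeff (coeff F j) i = 0" for i j
  proof (cases "i + j = Suc n")
    case False
    then show ?thesis using F(1) unfolding is_form_def by blast
  next
    case True
    \<comment> \<open>The pure power y^(n+1) is read off with (a, b) = (0, 1), every monomial
      divisible by x with (1, 0).\<close>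
    show ?thesis
    proof (cases i)
      case 0
      then show ?thesis using coeff_0[of 0 1 n] True by simp
    next
      case (Suc i')
      then have "j \<le> n" "n - j = i'" using True by auto
      then show ?thesis using coeff_0[of 1 0 j] Suc by simp
    qed
  qed
  then have "F = 0" by (simp add: poly_eq_iff)
  with F(2) show False by blast
qed

section \<open>Splitting a multiple line into distinct nearby lines\<close>

definition coeffs_cont :: "(real \<Rightarrow> bipoly) \<Rightarrow> bool" where
  "coeffs_cont g \<longleftrightarrow> (\<forall>i j. isCont (\<lambda>s. coeff (coeff (g s) j) i) 0)"

lemma coeffs_cont_mult:
  "coeffs_cont f \<Longrightarrow> coeffs_cont g \<Longrightarrow> coeffs_cont (\<lambda>s. f s * g s)"
  unfolding coeffs_cont_def coeff_mult coeff_sum by (auto intro!: continuous_intros)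

lemma coeffs_cont_prod:
  "(\<And>u. u \<in> U \<Longrightarrow> coeffs_cont (f u)) \<Longrightarrow> coeffs_cont (\<lambda>s. \<Prod>u\<in>U. f u s)"
proof (induction U rule: infinite_finite_induct)
  case (insert u U)
  then show ?case by (simp add: coeffs_cont_mult)
qed (simp_all add: coeffs_cont_def)

lemma coeffs_cont_line: "coeffs_cont (\<lambda>s. line (t + s * u))"
  unfolding coeffs_cont_def
proof (intro allI)
  show "isCont (\<lambda>s. coeff (coeff (line (t + s * u)) j) i) 0" for i j
    by (cases "i = 1 \<and> j = 0") (auto simp: coeff_coeff_line intro!: continuous_intros)
qed

text \<open>\<open>contr\<close> is linear in finitely many coefficients, so coefficientwise
  continuity is enough.\<close>

lemma isCont_contr: "coeffs_cont g \<Longrightarrow> isCont (\<lambda>s. contr n F a b (g s)) 0"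
  unfolding coeffs_cont_def contr_def by (auto intro!: continuous_intros)

text \<open>The slopes t + s u for u < n are distinct when s is nonzero and all tend to t as s tends
  to 0; nonvanishing persists for small s.\<close>

lemma ex_lines_contr_neq_0:
  assumes "contr (n + 2) F a b (line t ^ (n + 2)) \<noteq> 0"
  shows "\<exists>C. finite C \<and> card C = n \<and>
    (\<forall>c\<in>C. \<forall>e\<in>C. contr (n + 2) F a b ((\<Prod>c\<in>C. line c) * (line c * line e)) \<noteq> 0)"
proof -
  define g where "g = (\<lambda>i j s. (\<Prod>u<n. line (t + s * real u)) *
    (line (t + s * real i) * line (t + s * real j)))"
  have "\<forall>\<^sub>F s in at 0. contr (n + 2) F a b (g i j s) \<noteq> 0" for i j
  proof (rule tendsto_imp_eventually_ne)
    have "coeffs_cont (g i j)"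
      unfolding g_def by (intro coeffs_cont_mult coeffs_cont_prod coeffs_cont_line)
    then show "(\<lambda>s. contr (n + 2) F a b (g i j s)) \<midarrow>0\<rightarrow> contr (n + 2) F a b (g i j 0)"
      using isCont_contr isCont_def by blast
    have "g i j 0 = line t ^ (n + 2)"
      by (simp add: g_def power_add power2_eq_square)
    with assms show "contr (n + 2) F a b (g i j 0) \<noteq> 0" by simp
  qed
  \<comment> \<open>There are finitely many pairs (i, j), so one s serves them all.\<close>
  then have "\<forall>\<^sub>F s in at 0. \<forall>i\<in>{..<n}. \<forall>j\<in>{..<n}. contr (n + 2) F a b (g i j s) \<noteq> 0"
    by (intro eventually_ball_finite finite_lessThan ballI)
  moreover have "\<forall>\<^sub>F s :: real in at 0. s \<noteq> 0" by (simp add: eventually_at_filter)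
  ultimately have "\<forall>\<^sub>F s in at 0. s \<noteq> 0 \<and>
      (\<forall>i\<in>{..<n}. \<forall>j\<in>{..<n}. contr (n + 2) F a b (g i j s) \<noteq> 0)"
    by (intro eventually_conj)
  then obtain s where s: "s \<noteq> 0"
    "\<And>i j. i < n \<Longrightarrow> j < n \<Longrightarrow> contr (n + 2) F a b (g i j s) \<noteq> 0"
    using eventually_happens'[OF at_neq_bot] by (smt (verit) lessThan_iff)
  have inj: "inj_on (\<lambda>u. t + s * real u) {..<n}"
    using s(1) by (auto simp: inj_on_def)
  show ?thesis
  proof (intro exI[of _ "(\<lambda>u. t + s * real u) ` {..<n}"] conjI ballI)
    show "card ((\<lambda>u. t + s * real u) ` {..<n}) = n" using inj by (simp add: card_image)
  next
    fix c e
    assume "c \<in> (\<lambda>u. t + s * real u) ` {..<n}" "e \<in> (\<lambda>u. t + s * real u) ` {..<n}"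
    then show "contr (n + 2) F a b
        ((\<Prod>c\<in>(\<lambda>u. t + s * real u) ` {..<n}. line c) * (line c * line e)) \<noteq> 0"
      using s(2) by (auto simp: g_def prod.reindex[OF inj])
  qed simp
qed

section \<open>An apolar form of degree d - 1 with almost real roots\<close>

theorem theorem7p3:
  fixes d :: nat and F :: bipoly
  assumes "d \<ge> 3" and "F \<noteq> 0" and "is_form d F"
  shows "ar_rk F \<le> enat (d - 1)"
proof -
  define n where "n = d - 3"
  have d: "d = Suc (n + 2)" using assms(1) by (simp add: n_def)
  have F: "is_form (Suc (n + 2)) F" using assms(3) d by simp
  \<comment> \<open>The pair (a, b) selects the coefficient of x or of y that the forms P l l' will
    fail to annihilate.\<close>
  obtain t a b where ab: "a + b = 1" "contr (n + 2) F a b (line t ^ (n + 2)) \<noteq> 0"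
    using ex_contr_line_power_neq_0[OF F assms(2)] by blast
  obtain C where C: "finite C" "card C = n"
    and bad: "\<And>c e. c \<in> C \<Longrightarrow> e \<in> C \<Longrightarrow>
      contr (n + 2) F a b ((\<Prod>c\<in>C. line c) * (line c * line e)) \<noteq> 0"
    using ex_lines_contr_neq_0[OF ab(2)] by blast
  let ?P = "\<Prod>c\<in>C. line c"
  \<comment> \<open>The basis x^2, x y, y^2 of the quadratic forms.\<close>
  let ?X = "[:[:0, 0, 1:]:] :: bipoly" and ?Y = "[:0, [:0, 1:]:] :: bipoly"
    and ?Z = "[:0, 0, 1:] :: bipoly"
  let ?\<phi> = "contr (n + 2) F"
  obtain x y z where nz: "x \<noteq> 0 \<or> y \<noteq> 0 \<or> z \<noteq> 0"
    and eqs: "x * ?\<phi> 1 0 (?P * ?X) + y * ?\<phi> 1 0 (?P * ?Y) + z * ?\<phi> 1 0 (?P * ?Z) = 0"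
      "x * ?\<phi> 0 1 (?P * ?X) + y * ?\<phi> 0 1 (?P * ?Y) + z * ?\<phi> 0 1 (?P * ?Z) = 0"
    using two_equations_three_unknowns by blast
  define q :: bipoly where "q = [:[:0, 0, x:], [:0, y:], [:z:]:]"
  have "q = smult [:x:] ?X + smult [:y:] ?Y + smult [:z:] ?Z"
    by (simp add: q_def)
  then have "?P * q = smult [:x:] (?P * ?X) + smult [:y:] (?P * ?Y) + smult [:z:] (?P * ?Z)"
    by (simp only: distrib_left mult_smult_right)
  then have \<phi>: "?\<phi> i j (?P * q) =
      x * ?\<phi> i j (?P * ?X) + y * ?\<phi> i j (?P * ?Y) + z * ?\<phi> i j (?P * ?Z)" for i j
    by (simp only: contr_add contr_smult)
  have 0: "?\<phi> 1 0 (?P * q) = 0" "?\<phi> 0 1 (?P * q) = 0"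
    using eqs by (simp_all only: \<phi>)
  have "almost_real_roots (card C + 2) (?P * q)"
    unfolding q_def
  proof (rule almost_real_roots_lines_mult_quadratic[OF C(1) nz], fold q_def, rule notI)
    fix c e s
    assume ce: "c \<in> C" "e \<in> C" and q: "q = smult [:s:] (line c * line e)"
    have "q \<noteq> 0" using nz by (auto simp: q_def)
    then have "s \<noteq> 0" using q by auto
    \<comment> \<open>Both coefficients vanish for P q, in particular the one selected by (a, b),
      against \<open>bad\<close>.\<close>
    have "a = 1 \<and> b = 0 \<or> a = 0 \<and> b = 1" using ab(1) by linarith
    with 0 have "?\<phi> a b (?P * q) = 0" by auto
    then have "s * ?\<phi> a b (?P * (line c * line e)) = 0"
      by (simp only: q mult_smult_right contr_smult)
    with \<open>s \<noteq> 0\<close> bad[OF ce] show False by simp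
  qed
  then have arr: "almost_real_roots (n + 2) (?P * q)" by (simp add: C(2))
  then have "?P * q \<in> apolar_part F (n + 2)"
    using apolar_if_contr_eq_0[OF _ F 0] by (simp add: almost_real_roots_def)
  with arr have "ar_rk F \<le> enat (n + 2)"
    unfolding ar_rk_def by (intro INF_lower) blast
  then show ?thesis by (simp add: d)
qed

end
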